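(* Let $n\ge1$ be a natural number and let $\beta<\alpha\in\omega_1\cup\{\mathbb{N}\}$, where $\beta$ is a countable ordinal. Then $\mathsf{RT}^n_{\alpha,\beta}$ is not continuously $2$-guessable with identified errors.
   Context: **Convention.** The symbol $\mathbb{N}$, as a value of the parameter $\alpha$, counts as larger than every countable ordinal: $\beta<\mathbb{N}$ holds for all $\beta<\omega_1$. **Problems.** Identify $(\mathbb{N}\cup\{\#\})^{\mathbb{N}}$ with Baire space $\mathbb{N}^{\mathbb{N}}$ via $\#\mapsto0$, $n\mapsto n+1$. A problem $P:\subseteq\mathbb{N}^{\mathbb{N}}\rightrightarrows\mathbb{N}^{\mathbb{N}}$ is a partial multivalued function with instances $\mathrm{dom}(P)$ and solution sets $P(p)\subseteq\mathbb{N}^{\mathbb{N}}$, possibly empty. **Guessability.** Let $\bot$ be an extra symbol. A partial (single-valued) functional $\Theta:\subseteq\mathbb{N}^{\mathbb{N}}\to(\mathbb{N}\cup\{\bot\})^{\mathbb{N}}$ identifies its errors with respect to $P$ if for each $p\in\mathrm{dom}(P)$: if $\Theta(p)\notin P(p)$ then there is $j$ such that $\Theta(p)(j)$ is defined and equal to $\bot$. $P$ is continuously $m$-guessable with identified errors if there are partial continuous functionals $\Theta_0,\dots,\Theta_{m-1}:\subseteq\mathbb{N}^{\mathbb{N}}\to(\mathbb{N}\cup\{\bot\})^{\mathbb{N}}$, each of which identifies its errors with respect to $P$, such that for each $p\in\mathrm{dom}(P)$ there is $i<m$ with $\Theta_i(p)\in P(p)$. **The problems $\mathsf{RT}^n_{\alpha,\beta}$**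 ($n\ge1$). Fix a bijection $\langle\cdot\rangle:[\mathbb{N}]^n\to\mathbb{N}$, where $[A]^n$ is the set of $n$-element subsets of $A$; a coloring $c:[\mathbb{N}]^n\to\mathbb{N}$ is identified with the sequence $c\in\mathbb{N}^{\mathbb{N}}$, $c(\langle a_0,\dots,a_{n-1}\rangle)=c(a_0,\dots,a_{n-1})$. A set $A\subseteq\mathbb{N}$ is identified with its characteristic sequence, and a finite $0$–$1$ string $\phi$ with $\{i:\phi(i)=1\}$. For each $0<\gamma<\omega_1$ fix an enumeration (surjection, repetitions allowed) $w_\gamma:\mathbb{N}\to\gamma$, computable if $\gamma<\omega$. For a countable ordinal $\alpha$ and $\vec v=v_0\dots v_{k-1}\in\mathbb{N}^{<\mathbb{N}}$, put $s_\alpha(\vec v)=\gamma_0\dots\gamma_{k-1}$ where $\gamma_{-1}=\alpha$ and $\gamma_i=w_{\gamma_{i-1}}(v_i)$; it is undefined if some needed $w_{\gamma_{i-1}}$ has $\gamma_{i-1}=0$. So $s_\alpha(\vec v)$ is a strictly decreasing sequence of ordinals below $\alpha$. *Instances, $\alpha<\omega_1$.* Index $i$ adds a new color to $c$ if $c(i)\notin\{c(j):j<i\}$. If $c$ has exactly $k$ colors, first appearing at indices $m_0<\dots<m_{k-1}$, write $c=\theta_0\theta_1\cdots\theta_{k-1}r$ with $\theta_0\cdots\theta_i=c|_{m_i+1}$. For $\vec v=v_0\dots v_{k-1}\in\mathrm{dom}(s_\alpha)$ the sequence $\theta_0\#v_0\theta_1\#v_1\cdots\theta_{k-1}\#v_{k-1}r\in(\mathbb{N}\cup\{\#\})^{\mathbb{N}}$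 is a name of $(c,s_\alpha(\vec v))$. The instances of $\mathsf{RT}^n_{\alpha,\beta}$ are all such names, for all colorings $c$ with finitely many (say $k$) colors and all $\vec v\in\mathrm{dom}(s_\alpha)$ of length $k$. *Instances, $\alpha=\mathbb{N}$.* The instances of $\mathsf{RT}^n_{\mathbb{N},\beta}$ are the colorings $c:[\mathbb{N}]^n\to\mathbb{N}$ with finite range. *Solutions, $\beta<\omega_1$.* The solutions to an instance with coloring $c$ are all sequences $\phi_0\#v_0\phi_1\#v_1\cdots\phi_{k-1}\#v_{k-1}q$ such that $\phi_0\phi_1\cdots\phi_{k-1}q$ is (the characteristic sequence of) an infinite set $A\subseteq\mathbb{N}$ with $|c([A]^n)|\le k$, $\vec v=v_0\dots v_{k-1}\in\mathrm{dom}(s_\beta)$, and $|c([\phi_0\cdots\phi_{i-1}]^n)|\le i$ for all $i\le k$. *)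

theory Defs
  imports
    "HOL-Analysis.Analysis"
    "HOL-Library.Countable_Set_Type"
    "HOL-Library.Ramsey"
    "HOL-Library.Omega_Words_Fun"
begin

subsection \<open>Countable ordinals\<close>

text \<open>
  The field of the cardinal successor of \<open>natLeq\<close> is a well-order of type \<open>\<omega>\<^sub>1\<close>. Its elements
  serve as the countable ordinals; the ordinal \<open>\<gamma>\<close>, viewed as the set of its predecessors, is
  \<open>{..<\<gamma>}\<close>.
\<close>

lemma Well_order_cardSuc_natLeq: "Well_order (cardSuc natLeq)"
  using cardSuc_Card_order[OF natLeq_Card_order] card_order_on_well_order_on by blast

typedef omega1 = "Field (cardSuc natLeq)"
  using Field_cardSuc_not_empty[OF natLeq_Card_order] by blast

instantiation omega1 :: wellorder
begin

definition less_eq_omega1 :: "omega1 \<Rightarrow> omega1 \<Rightarrow> bool" where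
  "\<alpha> \<le> \<beta> \<longleftrightarrow> (Rep_omega1 \<alpha>, Rep_omega1 \<beta>) \<in> cardSuc natLeq"

definition less_omega1 :: "omega1 \<Rightarrow> omega1 \<Rightarrow> bool" where
  "\<alpha> < \<beta> \<longleftrightarrow> \<alpha> \<le> \<beta> \<and> \<alpha> \<noteq> (\<beta> :: omega1)"

instance
proof
  note wo = Well_order_cardSuc_natLeq[unfolded well_order_on_def linear_order_on_def
      partial_order_on_def preorder_on_def]
  have refl: "\<alpha> \<le> \<alpha>" for \<alpha> :: omega1
    using wo Rep_omega1[of \<alpha>] by (auto simp: less_eq_omega1_def refl_on_def)
  have antisym: "\<alpha> \<le> \<beta> \<Longrightarrow> \<beta> \<le> \<alpha> \<Longrightarrow> \<alpha> = \<beta>" for \<alpha> \<beta> :: omega1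
    using wo by (auto simp: less_eq_omega1_def dest: antisymD intro: Rep_omega1_inject[THEN iffD1])
  show "\<alpha> < \<beta> \<longleftrightarrow> \<alpha> \<le> \<beta> \<and> \<not> \<beta> \<le> \<alpha>" for \<alpha> \<beta> :: omega1
    using refl antisym by (auto simp: less_omega1_def)
  show "\<alpha> \<le> \<alpha>" for \<alpha> :: omega1 by (fact refl)
  show "\<alpha> \<le> \<beta> \<Longrightarrow> \<beta> \<le> \<gamma> \<Longrightarrow> \<alpha> \<le> \<gamma>" for \<alpha> \<beta> \<gamma> :: omega1
    using wo by (auto simp: less_eq_omega1_def dest: transD)
  show "\<alpha> \<le> \<beta> \<Longrightarrow> \<beta> \<le> \<alpha> \<Longrightarrow> \<alpha> = \<beta>" for \<alpha> \<beta> :: omega1 by (fact antisym)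
  show "\<alpha> \<le> \<beta> \<or> \<beta> \<le> \<alpha>" for \<alpha> \<beta> :: omega1
    using wo Rep_omega1[of \<alpha>] Rep_omega1[of \<beta>] refl[of \<alpha>]
    by (cases "\<alpha> = \<beta>") (auto simp: less_eq_omega1_def total_on_def Rep_omega1_inject)
  show "P \<alpha>" if step: "\<And>\<beta>. (\<And>\<gamma>. \<gamma> < \<beta> \<Longrightarrow> P \<gamma>) \<Longrightarrow> P \<beta>" for P and \<alpha> :: omega1
  proof -
    have "wf (inv_image (cardSuc natLeq - Id) Rep_omega1)"
      using wo by (intro wf_inv_image) blast
    then show ?thesis
    proof (induction \<alpha> rule: wf_induct_rule)
      case (less \<alpha>)
      show ?case
      proof (rule step)
        fix \<gamma> assume "\<gamma> < \<alpha>"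
        then have "(\<gamma>, \<alpha>) \<in> inv_image (cardSuc natLeq - Id) Rep_omega1"
          by (simp add: less_omega1_def less_eq_omega1_def Rep_omega1_inject)
        then show "P \<gamma>" by (rule less)
      qed
    qed
  qed
qed

end

instantiation omega1 :: zero
begin
definition zero_omega1 :: omega1 where "0 = (LEAST \<gamma> :: omega1. True)"
instance ..
end

lemma omega1_zero_le: "0 \<le> (\<gamma> :: omega1)"
  by (simp add: zero_omega1_def Least_le)

lemma countable_lessThan_omega1: "countable {..<\<gamma> :: omega1}"
proof -
  have co: "Card_order (cardSuc natLeq)" by (rule cardSuc_Card_order[OF natLeq_Card_order])
  have "(card_of (underS (cardSuc natLeq) (Rep_omega1 \<gamma>)), cardSuc natLeq) \<in> ordLess"
    by (rule card_of_underS[OF co Rep_omega1])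
  then have "(card_of (underS (cardSuc natLeq) (Rep_omega1 \<gamma>)), natLeq) \<in> ordLeq"
    using cardSuc_ordLeq_ordLess[OF natLeq_Card_order card_of_Card_order] by blast
  then have "countable (underS (cardSuc natLeq) (Rep_omega1 \<gamma>))"
    by (simp add: countable_card_le_natLeq)
  moreover have "Rep_omega1 ` {..<\<gamma>} \<subseteq> underS (cardSuc natLeq) (Rep_omega1 \<gamma>)"
    by (auto simp: underS_def less_omega1_def less_eq_omega1_def Rep_omega1_inject)
  ultimately have "countable (Rep_omega1 ` {..<\<gamma>})" by (rule countable_subset[rotated])
  then show ?thesis
    using countable_image_inj_on[of Rep_omega1] by (metis Rep_omega1_inject inj_onI)
qed

lemma uncountable_omega1: "uncountable (UNIV :: omega1 set)"
proof
  have co: "Card_order (cardSuc natLeq)" by (rule cardSuc_Card_order[OF natLeq_Card_order])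
  assume "countable (UNIV :: omega1 set)"
  then have "countable (range Rep_omega1)" by simp
  then have "countable (Field (cardSuc natLeq))"
    by (simp add: type_definition.Rep_range[OF type_definition_omega1])
  then have "(card_of (Field (cardSuc natLeq)), natLeq) \<in> ordLeq" by (simp add: countable_card_le_natLeq)
  then have "(cardSuc natLeq, natLeq) \<in> ordLeq"
    using card_of_Field_ordIso[OF co] ordIso_ordLeq_trans ordIso_symmetric by blast
  then show False
    using cardSuc_greater[OF natLeq_Card_order] not_ordLess_ordLeq by blast
qed

text \<open>
  The values of the parameter \<open>\<alpha>\<close>: a countable ordinal or the symbol \<open>\<nat>\<close>, the latter lying
  above all countable ordinals.
\<close>

datatype level = Ordinal omega1 | Naturals

fun below :: "omega1 \<Rightarrow> level \<Rightarrow> bool" where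
  "below \<beta> (Ordinal \<alpha>) \<longleftrightarrow> \<beta> < \<alpha>"
| "below \<beta> Naturals \<longleftrightarrow> True"


subsection \<open>Computable functions\<close>

text \<open>
  The total recursive functions of arity \<open>k\<close>, as functions on lists (only the values on lists
  of length \<open>k\<close> matter). Minimization is applied to regular functions only, which yields exactly
  the total computable functions.
\<close>

inductive recursive_fn :: "nat \<Rightarrow> (nat list \<Rightarrow> nat) \<Rightarrow> bool" where
  zero: "recursive_fn k (\<lambda>_. 0)"
| succ: "recursive_fn 1 (\<lambda>xs. Suc (xs ! 0))"
| proj: "i < k \<Longrightarrow> recursive_fn k (\<lambda>xs. xs ! i)"
| comp: "recursive_fn (length gs) f \<Longrightarrow> (\<forall>g\<in>set gs. recursive_fn k g) \<Longrightarrow>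
    recursive_fn k (\<lambda>xs. f (map (\<lambda>g. g xs) gs))"
| prec: "recursive_fn k f \<Longrightarrow> recursive_fn (Suc (Suc k)) g \<Longrightarrow>
    recursive_fn (Suc k)
      (\<lambda>xs. rec_nat (f (tl xs)) (\<lambda>m y. g (m # y # tl xs)) (hd xs))"
| mini: "recursive_fn (Suc k) f \<Longrightarrow> (\<forall>xs. length xs = k \<longrightarrow> (\<exists>y. f (y # xs) = 0)) \<Longrightarrow>
    recursive_fn k (\<lambda>xs. LEAST y. f (y # xs) = 0)"

definition computable :: "(nat \<Rightarrow> nat) \<Rightarrow> bool" where
  "computable f \<longleftrightarrow> (\<exists>F. recursive_fn 1 F \<and> (\<forall>x. f x = F [x]))"


subsection \<open>Problems and guessability\<close>

text \<open>Here \<open>nat \<Rightarrow> nat\<close> is Baire space; the library topology on it is the product topology.\<close>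

datatype problem =
  Problem (instances: "(nat \<Rightarrow> nat) set") (solutions: "(nat \<Rightarrow> nat) \<Rightarrow> (nat \<Rightarrow> nat) set")

datatype nat_bot = Bot | Val nat

text \<open>
  A partial functional takes \<open>p\<close> to a possibly only partially defined sequence: \<open>\<Theta> p j = None\<close>
  means that the \<open>j\<close>-th value is undefined. A functional whose values are either entirely
  defined or entirely undefined is the special case in which the sets \<open>{p. \<Theta> p j \<noteq> None}\<close> agree
  for all \<open>j\<close>; continuity into the product space is then continuity of every coordinate.
\<close>

type_synonym functional = "(nat \<Rightarrow> nat) \<Rightarrow> nat \<Rightarrow> nat_bot option"

definition continuous_functional :: "functional \<Rightarrow> bool" where
  "continuous_functional \<Theta> \<longleftrightarrow>
    (\<forall>j. continuous_map (top_of_set {p. \<Theta> p j \<noteq> None}) (discrete_topology UNIV)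
           (\<lambda>p. the (\<Theta> p j)))"

definition solves :: "functional \<Rightarrow> problem \<Rightarrow> (nat \<Rightarrow> nat) \<Rightarrow> bool" where
  "solves \<Theta> P p \<longleftrightarrow> (\<exists>q\<in>solutions P p. \<Theta> p = (\<lambda>j. Some (Val (q j))))"

definition identifies_errors :: "functional \<Rightarrow> problem \<Rightarrow> bool" where
  "identifies_errors \<Theta> P \<longleftrightarrow>
    (\<forall>p\<in>instances P. \<not> solves \<Theta> P p \<longrightarrow> (\<exists>j. \<Theta> p j = Some Bot))"

definition guessable_with_identified_errors :: "nat \<Rightarrow> problem \<Rightarrow> bool" where
  "guessable_with_identified_errors m P \<longleftrightarrow>
    (\<exists>\<Theta> :: nat \<Rightarrow> functional.
      (\<forall>i<m. continuous_functional (\<Theta> i) \<and> identifies_errors (\<Theta> i) P) \<and>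
      (\<forall>p\<in>instances P. \<exists>i<m. solves (\<Theta> i) P p))"


subsection \<open>Descending sequences of ordinals\<close>

text \<open>\<open>descent w \<alpha> vs\<close> is \<open>s\<^sub>\<alpha>(vs)\<close>, with \<open>None\<close> for undefined.\<close>

fun descent :: "(omega1 \<Rightarrow> nat \<Rightarrow> omega1) \<Rightarrow> omega1 \<Rightarrow> nat list \<Rightarrow> omega1 list option" where
  "descent w \<gamma> [] = Some []"
| "descent w \<gamma> (v # vs) =
    (if \<gamma> = 0 then None else map_option ((#) (w \<gamma> v)) (descent w (w \<gamma> v) vs))"

text \<open>
  Admissible systems of enumerations. A finite ordinal \<open>\<delta>\<close> is the number \<open>card {..<\<delta>}\<close>.
\<close>

definition enumeration_system :: "(omega1 \<Rightarrow> nat \<Rightarrow> omega1) \<Rightarrow> bool" where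
  "enumeration_system w \<longleftrightarrow>
    (\<forall>\<gamma>>0. range (w \<gamma>) = {..<\<gamma>} \<and>
      (finite {..<\<gamma>} \<longrightarrow> computable (\<lambda>i. card {..<w \<gamma> i})))"


subsection \<open>The problems\<close>

text \<open>In \<open>nat option\<close>, the symbol \<open>#\<close> is \<open>None\<close>.\<close>

definition encode :: "(nat \<Rightarrow> nat option) \<Rightarrow> (nat \<Rightarrow> nat)" where
  "encode x = (\<lambda>i. case x i of None \<Rightarrow> 0 | Some m \<Rightarrow> Suc m)"

text \<open>The sequence \<open>\<theta>\<^sub>0 # v\<^sub>0 \<theta>\<^sub>1 # v\<^sub>1 \<dots> \<theta>\<^bsub>k-1\<^esub> # v\<^bsub>k-1\<^esub> r\<close>.\<close>

definition weave :: "nat list list \<Rightarrow> nat list \<Rightarrow> (nat \<Rightarrow> nat) \<Rightarrow> (nat \<Rightarrow> nat option)" where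
  "weave \<theta>s vs r =
    concat (map2 (\<lambda>\<theta> v. map Some \<theta> @ [None, Some v]) \<theta>s vs) \<frown> (\<lambda>i. Some (r i))"

definition adds_new_color :: "(nat \<Rightarrow> nat) \<Rightarrow> nat \<Rightarrow> bool" where
  "adds_new_color c i \<longleftrightarrow> c i \<notin> c ` {..<i}"

text \<open>The increasing list \<open>m\<^sub>0 < \<dots> < m\<^bsub>k-1\<^esub>\<close> of first appearances (for \<open>c\<close> with finite range).\<close>

definition new_color_indices :: "(nat \<Rightarrow> nat) \<Rightarrow> nat list" where
  "new_color_indices c = sorted_list_of_set {i. adds_new_color c i}"

text \<open>
  \<open>is_name w \<alpha> c p\<close>: the sequence \<open>p\<close> is an instance with underlying coloring \<open>c\<close>. At level \<open>\<nat>\<close>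
  the instance is the coloring itself, not passed through \<open>encode\<close>.
\<close>

fun is_name :: "(omega1 \<Rightarrow> nat \<Rightarrow> omega1) \<Rightarrow> level \<Rightarrow> (nat \<Rightarrow> nat) \<Rightarrow> (nat \<Rightarrow> nat) \<Rightarrow> bool" where
  "is_name w (Ordinal \<alpha>) c p \<longleftrightarrow>
    finite (range c) \<and>
    (\<exists>\<theta>s vs r.
      length \<theta>s = card (range c) \<and> length vs = card (range c) \<and>
      c = concat \<theta>s \<frown> r \<and>
      (\<forall>i<card (range c).
        concat (take (Suc i) \<theta>s) = map c [0..<new_color_indices c ! i + 1]) \<and>
      descent w \<alpha> vs \<noteq> None \<and>
      p = encode (weave \<theta>s vs r))"
| "is_name w Naturals c p \<longleftrightarrow> finite (range c) \<and> p = c"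

text \<open>The set coded by a finite \<open>0\<close>-\<open>1\<close> string.\<close>

definition string_set :: "nat list \<Rightarrow> nat set" where
  "string_set \<phi> = {i. i < length \<phi> \<and> \<phi> ! i = 1}"

text \<open>
  The colors attained on \<open>[A]\<^bsup>n\<^esup>\<close>, where \<open>code\<close> is the fixed bijection from \<open>[\<nat>]\<^bsup>n\<^esup>\<close> to \<open>\<nat>\<close>.
\<close>

definition colors :: "(nat set \<Rightarrow> nat) \<Rightarrow> nat \<Rightarrow> (nat \<Rightarrow> nat) \<Rightarrow> nat set \<Rightarrow> nat set" where
  "colors code n c A = (\<lambda>X. c (code X)) ` [A]\<^bsup>n\<^esup>"

definition is_solution ::
    "(nat set \<Rightarrow> nat) \<Rightarrow> (omega1 \<Rightarrow> nat \<Rightarrow> omega1) \<Rightarrow> nat \<Rightarrow> omega1 \<Rightarrow>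
      (nat \<Rightarrow> nat) \<Rightarrow> (nat \<Rightarrow> nat) \<Rightarrow> bool" where
  "is_solution code w n \<beta> c s \<longleftrightarrow>
    (\<exists>k A \<phi>s vs q.
      length \<phi>s = k \<and> length vs = k \<and>
      infinite A \<and> concat \<phi>s \<frown> q = indicator A \<and>
      card (colors code n c A) \<le> k \<and>
      descent w \<beta> vs \<noteq> None \<and>
      (\<forall>i\<le>k. card (colors code n c (string_set (concat (take i \<phi>s)))) \<le> i) \<and>
      s = encode (weave \<phi>s vs q))"

definition RT ::
    "(nat set \<Rightarrow> nat) \<Rightarrow> (omega1 \<Rightarrow> nat \<Rightarrow> omega1) \<Rightarrow> nat \<Rightarrow> level \<Rightarrow> omega1 \<Rightarrow> problem" where
  "RT code w n \<alpha> \<beta> =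
    Problem {p. \<exists>c. is_name w \<alpha> c p}
      (\<lambda>p. {s. \<exists>c. is_name w \<alpha> c p \<and> is_solution code w n \<beta> c s})"

end

theory Submission
  imports Defs
begin

text \<open>
  The proof is a game against the functionals. The opponent feeds them an instance whose coloring
  is eventually constant with a newly introduced color \<open>j\<close>, where \<open>0, \<dots>, j - 1\<close> are the earlier
  colors. Each functional that solves this instance produces an infinite set and finitely many
  \<open>#\<close>-marks. The opponent waits until, by continuity, a finite prefix of the instance fixes all
  these marks and enough of the set to show all colors \<open>0, \<dots>, j\<close>, and by the \<open>\<bottom>\<close> in
  its output rules out each functional that fails. Only then is the next color \<open>j + 1\<close> introduced. From
  that moment on failed functionals stay failed, and the set of each remaining functional
  already has \<open>j + 1\<close> colors.

  Under this strategy a functional solving the instance at stage \<open>j\<close> has made at least \<open>j + 1\<close>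
  marks, and the ordinals attached to the first \<open>j\<close> of them were fixed at earlier stages. Hence
  the \<open>(j + 1)\<close>-st ordinals of the solving functionals lie strictly below their \<open>j\<close>-th ones
  (below \<open>\<beta>\<close> when \<open>j = 0\<close>). So if the opponent attaches \<open>\<beta>\<close> to color \<open>0\<close>, which is possible since
  \<open>\<beta> < \<alpha>\<close>, and to each later color the largest ordinal just spent by a solving functional, then
  these ordinals decrease strictly and the opponent's moves are legal. If the functionals always
  covered all instances, the game would never end, and the ordinals would decrease forever.
  For \<open>\<alpha> = \<nat>\<close> the opponent plays the same colorings and the ordinals only count the moves of the
  functionals.

  One round of the game for a single functional is \<open>pressed_step\<close>, the opponent's move is
  \<open>position_extend\<close>, and \<open>pressed_position_impossible\<close> is the infinite descent.
\<close>

section \<open>Continuous functionals near a point\<close>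

abbreviation agree :: "nat \<Rightarrow> (nat \<Rightarrow> 'a) \<Rightarrow> (nat \<Rightarrow> 'a) \<Rightarrow> bool" where
  "agree L p q \<equiv> \<forall>i<L. q i = p i"

lemma agree_if_eventually_nhds:
  fixes p :: "nat \<Rightarrow> nat"
  assumes "eventually P (nhds p)"
  shows "\<exists>L. \<forall>q. agree L p q \<longrightarrow> P q"
proof -
  obtain T where T: "open T" "p \<in> T" "\<And>q. q \<in> T \<Longrightarrow> P q"
    using assms unfolding eventually_nhds by blast
  then have "openin (product_topology (\<lambda>i. euclidean) UNIV) T"
    by (simp add: open_fun_def)
  then obtain U where fin: "finite {i. U i \<noteq> (UNIV :: nat set)}"
    and U: "p \<in> Pi\<^sub>E UNIV U" "Pi\<^sub>E UNIV U \<subseteq> T"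
    using \<open>p \<in> T\<close> unfolding openin_product_topology_alt by fastforce
  obtain L where L: "\<And>i. U i \<noteq> UNIV \<Longrightarrow> i < L"
    using fin unfolding finite_nat_set_iff_bounded by blast
  have "q \<in> Pi\<^sub>E UNIV U" if "agree L p q" for q
  proof (rule PiE_I)
    fix i
    show "q i \<in> U i"
    proof (cases "U i = UNIV")
      case False
      then have "q i = p i" using that L by blast
      then show ?thesis using PiE_mem[OF U(1)] by auto
    qed simp
  qed simp
  then have "P q" if "agree L p q" for q
    using that by (intro T(3) subsetD[OF U(2)])
  then show ?thesis by (intro exI[of _ L] allI impI)
qed

lemma eventually_same_value:
  assumes "continuous_functional \<Theta>" and "\<Theta> p j \<noteq> None"
  shows "\<forall>\<^sub>F q in nhds p. \<Theta> q j = None \<or> \<Theta> q j = \<Theta> p j"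
proof -
  let ?D = "{p. \<Theta> p j \<noteq> None}"
  have "openin (top_of_set ?D) {q \<in> ?D. the (\<Theta> q j) \<in> {the (\<Theta> p j)}}"
    using openin_continuous_map_preimage[of "top_of_set ?D" "discrete_topology UNIV"
        "\<lambda>p. the (\<Theta> p j)" "{the (\<Theta> p j)}"] assms(1)
    unfolding continuous_functional_def by simp
  then obtain T where T: "open T" "{q \<in> ?D. the (\<Theta> q j) \<in> {the (\<Theta> p j)}} = ?D \<inter> T"
    unfolding openin_open by blast
  have "p \<in> T" using T(2) assms(2) by blast
  have "\<Theta> q j = None \<or> \<Theta> q j = \<Theta> p j" if "q \<in> T" for q
  proof (cases "\<Theta> q j = None")
    case False
    then have "q \<in> {q \<in> ?D. the (\<Theta> q j) \<in> {the (\<Theta> p j)}}"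
      unfolding T(2) using that by simp
    then show ?thesis
      using assms(2) by auto
  qed simp
  then show ?thesis
    unfolding eventually_nhds using T(1) \<open>p \<in> T\<close> by blast
qed

text \<open>
  Failure at \<open>p\<close> is witnessed by a single \<open>\<bottom>\<close>, hence persists near \<open>p\<close>; this is where the identification
  of errors enters. Near \<open>p\<close> an output value may become undefined, as the domain of a partial
  continuous functional need not be open, but then the functional solves nothing there.
\<close>

lemma eventually_solves_only_if:
  assumes cont: "continuous_functional \<Theta>" and err: "identifies_errors \<Theta> P"
    and p: "p \<in> instances P"
  shows "\<forall>\<^sub>F q in nhds p. solves \<Theta> P q \<longrightarrow> solves \<Theta> P p \<and> agree N (\<Theta> p) (\<Theta> q)"
proof (cases "solves \<Theta> P p")
  case True
  then have "\<Theta> p j \<noteq> None" for j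
    by (auto simp: solves_def)
  then have "\<forall>\<^sub>F q in nhds p. \<forall>j\<in>{..<N}. \<Theta> q j = None \<or> \<Theta> q j = \<Theta> p j"
    by (intro eventually_ball_finite ballI eventually_same_value cont) auto
  then show ?thesis
    by (rule eventually_mono) (use True in \<open>auto simp: solves_def\<close>)
next
  case False
  then obtain j where j: "\<Theta> p j = Some Bot"
    using err p unfolding identifies_errors_def by blast
  show ?thesis
    by (rule eventually_mono[OF eventually_same_value[OF cont, of p j]])
      (use j in \<open>auto simp: solves_def dest: fun_cong[where x = j]\<close>)
qed


section \<open>Reading interleaved sequences\<close>

lemma weave_Nil: "weave [] vs r = (\<lambda>i. Some (r i))"
  by (simp add: weave_def)

lemma weave_Cons: "weave (\<theta> # \<theta>s) (v # vs) r = (map Some \<theta> @ [None, Some v]) \<frown> weave \<theta>s vs r"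
  by (simp add: weave_def conc_conc)

lemma weave_append:
  assumes "length \<theta>s = length vs"
  shows "weave (\<theta>s @ \<theta>s') (vs @ vs') r =
    concat (map2 (\<lambda>\<theta> v. map Some \<theta> @ [None, Some v]) \<theta>s vs) \<frown> weave \<theta>s' vs' r"
  using assms by (simp add: weave_def conc_conc)

lemma weave_Cons_nth:
  "weave (\<theta> # \<theta>s) (v # vs) r i =
    (if i < length \<theta> then Some (\<theta> ! i) else if i = length \<theta> then None
     else if i = Suc (length \<theta>) then Some v else weave \<theta>s vs r (i - length \<theta> - 2))"
  by (auto simp: weave_Cons conc_def nth_append nth_Cons')

text \<open>
  Interleaved sequences can be parsed from left to right: the first \<open>#\<close> ends the first block and is
  followed by the first number. So a prefix that reaches past the last mark of one sequence
  determines all its blocks in any other sequence with that prefix. The \<open>M\<close> further entries may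
  belong to later blocks of the other sequence, but contain no mark.
\<close>

lemma weave_initial_segment:
  assumes "length \<theta>s = length vs" and "length \<theta>s' = length vs'"
    and "agree (length (concat \<theta>s) + 2 * length \<theta>s + M) (weave \<theta>s vs r) (weave \<theta>s' vs' r')"
  shows "take (length vs) vs' = vs \<and> agree M (concat \<theta>s \<frown> r) (concat \<theta>s' \<frown> r')"
  using assms
proof (induction \<theta>s vs arbitrary: \<theta>s' vs' rule: list_induct2)
  case Nil
  show ?case
  proof (cases \<theta>s')
    case Nil
    with Nil.prems show ?thesis
      by (auto simp: weave_Nil)
  next
    case (Cons \<theta> \<theta>s'')
    then obtain v vs'' where vs': "vs' = v # vs''"
      using Nil.prems by (cases vs') auto
    have eq: "weave (\<theta> # \<theta>s'') (v # vs'') r' i = Some (r i)" if "i < M" for i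
      using Nil.prems that Cons vs' by (auto simp: weave_Nil)
    \<comment> \<open>The mark after \<open>\<theta>\<close> differs from every entry of \<open>r\<close>, so it lies beyond the common prefix.\<close>
    have "\<not> length \<theta> < M"
      using eq[of "length \<theta>"] by (auto simp: weave_Cons_nth)
    then show ?thesis
      using eq Cons by (auto simp: weave_Cons_nth conc_def nth_append)
  qed
next
  case (Cons \<theta> \<theta>s v vs)
  let ?N = "length (concat (\<theta> # \<theta>s)) + 2 * length (\<theta> # \<theta>s) + M"
  have eq: "weave \<theta>s' vs' r' i = weave (\<theta> # \<theta>s) (v # vs) r i" if "i < ?N" for i
    using Cons.prems(2) that by blast
  have "weave \<theta>s' vs' r' (length \<theta>) = None"
    using eq[of "length \<theta>"] by (simp add: weave_Cons_nth)
  then obtain \<theta>' \<theta>s'' where \<theta>s': "\<theta>s' = \<theta>' # \<theta>s''"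
    by (cases \<theta>s') (auto simp: weave_Nil)
  then obtain v' vs'' where vs': "vs' = v' # vs''"
    using Cons.prems(1) by (cases vs') auto
  note eq = eq[unfolded \<theta>s' vs']
  have "\<not> length \<theta>' < length \<theta>"
    using eq[of "length \<theta>'"] by (auto simp: weave_Cons_nth)
  moreover have "\<not> length \<theta> < length \<theta>'"
    using eq[of "length \<theta>"] by (auto simp: weave_Cons_nth)
  ultimately have len: "length \<theta>' = length \<theta>" by simp
  have "\<theta>' ! i = \<theta> ! i" if "i < length \<theta>" for i
    using eq[of i] that len by (simp add: weave_Cons_nth)
  then have \<theta>': "\<theta>' = \<theta>" using len by (simp add: list_eq_iff_nth_eq)
  have v': "v' = v"
    using eq[of "Suc (length \<theta>)"] len by (simp add: weave_Cons_nth)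
  have "agree (length (concat \<theta>s) + 2 * length \<theta>s + M) (weave \<theta>s vs r) (weave \<theta>s'' vs'' r')"
  proof (intro allI impI)
    fix i assume "i < length (concat \<theta>s) + 2 * length \<theta>s + M"
    then show "weave \<theta>s'' vs'' r' i = weave \<theta>s vs r i"
      using eq[of "i + length \<theta> + 2"] \<theta>' by (simp add: weave_Cons_nth)
  qed
  then have IH: "take (length vs) vs'' = vs \<and> agree M (concat \<theta>s \<frown> r) (concat \<theta>s'' \<frown> r')"
    using Cons.IH[of \<theta>s'' vs''] Cons.prems(1) \<theta>s' vs' by simp
  then have "agree M (\<theta> \<frown> (concat \<theta>s \<frown> r)) (\<theta> \<frown> (concat \<theta>s'' \<frown> r'))"
    by (simp only: conc_def) simp
  then show ?case
    using IH by (simp add: \<theta>s' vs' \<theta>' v')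
qed

lemma encode_eq_iff: "encode x i = encode y i \<longleftrightarrow> x i = y i"
  by (auto simp: encode_def split: option.splits)

lemma is_name_unique:
  assumes "is_name w \<alpha> c p" and "is_name w \<alpha> c' p"
  shows "c' = c"
proof (cases \<alpha>)
  case (Ordinal a)
  obtain \<theta>s vs r where 1: "length \<theta>s = length vs" "c = concat \<theta>s \<frown> r"
      "p = encode (weave \<theta>s vs r)"
    using assms(1) unfolding Ordinal is_name.simps by metis
  obtain \<theta>s' vs' r' where 2: "length \<theta>s' = length vs'" "c' = concat \<theta>s' \<frown> r'"
      "p = encode (weave \<theta>s' vs' r')"
    using assms(2) unfolding Ordinal is_name.simps by metis
  have "weave \<theta>s' vs' r' = weave \<theta>s vs r"
    using 1 2 encode_eq_iff by (metis ext)
  then have "agree M (concat \<theta>s \<frown> r) (concat \<theta>s' \<frown> r')" for M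
    using weave_initial_segment[OF 1(1) 2(1), where M = M and r = r and r' = r'] by simp
  then show ?thesis
    unfolding 1(2) 2(2) by (intro ext) blast
qed (use assms in auto)


section \<open>Descents of ordinals\<close>

lemma descent_snoc:
  "descent w \<gamma> (vs @ [v]) \<noteq> None \<longleftrightarrow> descent w \<gamma> vs \<noteq> None \<and> foldl w \<gamma> vs \<noteq> 0"
  by (induction vs arbitrary: \<gamma>) auto

lemma descent_decreases:
  assumes "enumeration_system w" and "descent w \<gamma> vs \<noteq> None" and "i < length vs"
  shows "foldl w \<gamma> (take (Suc i) vs) < foldl w \<gamma> (take i vs)"
  using assms(2,3)
proof (induction vs arbitrary: \<gamma> i)
  case (Cons v vs)
  then have "\<gamma> \<noteq> 0" by auto
  then have "\<gamma> > 0"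
    using omega1_zero_le[of \<gamma>] by (simp add: order_less_le)
  then have "w \<gamma> v < \<gamma>"
    using assms(1) unfolding enumeration_system_def by blast
  with Cons show ?case
    by (cases i) (auto split: if_splits)
qed simp

lemma enumeration_system_surj:
  assumes "enumeration_system w" and "\<delta> < \<gamma>"
  obtains v where "w \<gamma> v = \<delta>"
proof -
  have "\<gamma> > 0" using omega1_zero_le[of \<delta>] assms(2) by (rule order.strict_trans1)
  then have "\<delta> \<in> range (w \<gamma>)"
    using assms unfolding enumeration_system_def by blast
  then show thesis using that by blast
qed


section \<open>Instances that keep adding colors\<close>

text \<open>
  The blocks \<open>\<theta>\<^sub>0, \<dots>, \<theta>\<^sub>j\<close> of a coloring in which color \<open>i\<close> is used until color \<open>i + 1\<close> appears. The
  waiting times \<open>L\<close> are left open, as they depend on the functionals.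
\<close>

inductive staircase :: "nat \<Rightarrow> nat list list \<Rightarrow> bool" where
  base: "staircase 0 [[0]]"
| step: "staircase j \<theta>s \<Longrightarrow> staircase (Suc j) (\<theta>s @ [replicate L j @ [Suc j]])"

lemma sorted_list_of_set_insert_greatest:
  fixes S :: "nat set"
  assumes "finite S" and "\<And>i. i \<in> S \<Longrightarrow> i < N"
  shows "sorted_list_of_set (insert N S) = sorted_list_of_set S @ [N]"
proof (rule sorted_distinct_set_unique)
  show "set (sorted_list_of_set (insert N S)) = set (sorted_list_of_set S @ [N])"
    using assms by (simp del: sorted_list_of_set_insert_remove)
  show "sorted (sorted_list_of_set S @ [N])" "distinct (sorted_list_of_set S @ [N])"
    using assms by (auto simp: sorted_append less_imp_le)
qed (simp_all del: sorted_list_of_set_insert_remove)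

text \<open>
  Each block ends exactly at the first appearance of its color, as the definition of a name
  requires.
\<close>

lemma staircase_props:
  assumes "staircase j \<theta>s"
  shows "length \<theta>s = Suc j \<and> set (concat \<theta>s) = {..j} \<and> (\<forall>\<theta>\<in>set \<theta>s. \<theta> \<noteq> []) \<and>
    new_color_indices (concat \<theta>s \<frown> (\<lambda>_. j)) =
      map (\<lambda>i. length (concat (take (Suc i) \<theta>s)) - 1) [0..<Suc j]"
  using assms
proof induction
  case base
  have "([0] \<frown> (\<lambda>_. 0)) = (\<lambda>_. 0 :: nat)"
    by (auto simp: conc_def)
  moreover have "{i. adds_new_color (\<lambda>_. 0) i} = {0}"
    by (auto simp: adds_new_color_def)
  ultimately show ?case
    by (auto simp: new_color_indices_def)
next
  case (step j \<theta>s L)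
  define c where "c = concat \<theta>s \<frown> (\<lambda>_. j)"
  define c' where "c' = concat (\<theta>s @ [replicate L j @ [Suc j]]) \<frown> (\<lambda>_. Suc j)"
  define N where "N = length (concat \<theta>s) + L"
  have set: "set (concat \<theta>s) = {..j}" using step by blast
  have c'_below: "c' i = c i" if "i < N" for i
    using that by (auto simp: c_def c'_def N_def conc_def nth_append)
  have c'_above: "c' i = Suc j" if "i \<ge> N" for i
    using that unfolding c'_def N_def conc_def by (auto simp: nth_append nth_Cons')
  have c_le: "c i \<le> j" for i
  proof (cases "i < length (concat \<theta>s)")
    case True
    then have "concat \<theta>s ! i \<in> {..j}" using set nth_mem by blast
    then show ?thesis using True by (simp add: c_def conc_def)
  qed (simp add: c_def conc_def)
  obtain a where a: "a < length (concat \<theta>s)" "concat \<theta>s ! a = j"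
    using set by (metis atMost_iff in_set_conv_nth order_refl)
  have c_old: "i < N" if "adds_new_color c i" for i
  proof (rule ccontr)
    assume "\<not> i < N"
    then have i: "i \<ge> length (concat \<theta>s)" by (simp add: N_def)
    then have "c i = c a" using a by (simp add: c_def conc_def)
    moreover have "a < i" using a i by simp
    ultimately show False using that by (auto simp: adds_new_color_def)
  qed
  have iff: "adds_new_color c' i \<longleftrightarrow> i = N \<or> adds_new_color c i" for i
  proof -
    consider "i < N" | "i = N" | "i > N" by linarith
    then show ?thesis
    proof cases
      case 1
      then have "c' ` {..<i} = c ` {..<i}" by (intro image_cong) (auto simp: c'_below)
      then show ?thesis using 1 by (simp add: adds_new_color_def c'_below)
    next
      case 2
      have "c' k \<noteq> Suc j" if "k < N" for k
        using c_le[of k] c'_below[OF that] by simp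
      then have "Suc j \<notin> c' ` {..<N}" by (metis imageE lessThan_iff)
      then show ?thesis using 2 by (simp add: adds_new_color_def c'_above)
    next
      case 3
      then have "c' i = c' N" "N \<in> {..<i}" by (auto simp: c'_above)
      then have "\<not> adds_new_color c' i" by (auto simp: adds_new_color_def)
      then show ?thesis using 3 c_old[of i] by auto
    qed
  qed
  then have new: "{i. adds_new_color c' i} = insert N {i. adds_new_color c i}"
    by auto
  have "finite {i. adds_new_color c i}"
    by (rule finite_subset[of _ "{..<N}"]) (use c_old in auto)
  then have "new_color_indices c' = new_color_indices c @ [N]"
    unfolding new_color_indices_def new
    by (rule sorted_list_of_set_insert_greatest) (use c_old in auto)
  also have "new_color_indices c = map (\<lambda>i. length (concat (take (Suc i) \<theta>s)) - 1) [0..<Suc j]"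
    using step.IH c_def by simp
  finally have "new_color_indices c' = map (\<lambda>i. length (concat (take (Suc i) \<theta>s)) - 1) [0..<Suc j] @ [N]" .
  then show ?case
    using step.IH unfolding c'_def by (auto simp: N_def)
qed

text \<open>
  A position of the game: \<open>p\<close> is a name of the coloring \<open>c\<close>, the colors \<open>0, \<dots>, j\<close> have been introduced,
  and \<open>\<gamma>\<close> is the ordinal attached to color \<open>j\<close>. At level \<open>\<nat>\<close> there is no such ordinal and \<open>\<gamma>\<close> is
  arbitrary, which lets both kinds of levels share one induction on \<open>\<gamma>\<close>.
\<close>

definition position ::
    "(omega1 \<Rightarrow> nat \<Rightarrow> omega1) \<Rightarrow> level \<Rightarrow> nat \<Rightarrow> omega1 \<Rightarrow> (nat \<Rightarrow> nat) \<Rightarrow> (nat \<Rightarrow> nat) \<Rightarrow> bool" where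
  "position w \<alpha> j \<gamma> c p \<longleftrightarrow>
    (\<exists>\<theta>s. staircase j \<theta>s \<and> c = concat \<theta>s \<frown> (\<lambda>_. j) \<and>
      (case \<alpha> of
        Ordinal a \<Rightarrow> \<exists>vs. length vs = Suc j \<and> descent w a vs \<noteq> None \<and> foldl w a vs = \<gamma> \<and>
          p = encode (weave \<theta>s vs (\<lambda>_. j))
      | Naturals \<Rightarrow> p = c))"

lemma range_conc: "range (xs \<frown> (\<lambda>_. j)) = insert j (set xs)"
proof -
  have "x \<in> range (xs \<frown> (\<lambda>_. j))" if x: "x \<in> set xs" for x
  proof -
    obtain i where "i < length xs" "xs ! i = x" using x by (metis in_set_conv_nth)
    then have "x = (xs \<frown> (\<lambda>_. j)) i" by simp
    then show ?thesis by (rule range_eqI)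
  qed
  moreover have "j \<in> range (xs \<frown> (\<lambda>_. j))"
    by (rule range_eqI[of _ _ "length xs"]) simp
  ultimately show ?thesis by (auto simp: conc_def)
qed

lemma position_is_name:
  assumes "position w \<alpha> j \<gamma> c p"
  shows "is_name w \<alpha> c p"
proof -
  obtain \<theta>s where st: "staircase j \<theta>s" and c: "c = concat \<theta>s \<frown> (\<lambda>_. j)"
    and rest: "case \<alpha> of
        Ordinal a \<Rightarrow> \<exists>vs. length vs = Suc j \<and> descent w a vs \<noteq> None \<and> foldl w a vs = \<gamma> \<and>
          p = encode (weave \<theta>s vs (\<lambda>_. j))
      | Naturals \<Rightarrow> p = c"
    using assms unfolding position_def by blast
  note props = staircase_props[OF st]
  have "range c = {..j}"
    using props unfolding c range_conc by auto
  then have card: "card (range c) = Suc j" "finite (range c)" by simp_all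
  have blocks: "concat (take (Suc i) \<theta>s) = map c [0..<new_color_indices c ! i + 1]" if "i < Suc j" for i
  proof -
    let ?t = "concat (take (Suc i) \<theta>s)"
    have "length \<theta>s = Suc j" and "\<forall>\<theta>\<in>set \<theta>s. \<theta> \<noteq> []" using props by blast+
    then have "?t \<noteq> []" by (cases \<theta>s) auto
    then have "length ?t > 0" by simp
    then have len: "new_color_indices c ! i + 1 = length ?t"
      using props that unfolding c by (simp del: upt_Suc)
    have "concat \<theta>s = ?t @ concat (drop (Suc i) \<theta>s)"
      by (metis append_take_drop_id concat_append)
    then have "c k = ?t ! k" if "k < length ?t" for k
      using that unfolding c conc_def by (simp add: nth_append)
    then have "map c [0..<length ?t] = ?t"
      by (intro nth_equalityI) auto
    then show ?thesis using len by simp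
  qed
  show ?thesis
  proof (cases \<alpha>)
    case (Ordinal a)
    then obtain vs where "length vs = Suc j" "descent w a vs \<noteq> None"
        "p = encode (weave \<theta>s vs (\<lambda>_. j))"
      using rest by auto
    then show ?thesis
      using props card blocks c unfolding Ordinal is_name.simps
      by (intro conjI exI[of _ \<theta>s] exI[of _ vs] exI[of _ "\<lambda>_. j"]) auto
  next
    case Naturals
    then show ?thesis using rest card by simp
  qed
qed

lemma position_eventually_constant:
  assumes "position w \<alpha> j \<gamma> c p"
  shows "\<exists>M. \<forall>i\<ge>M. c i = j"
proof -
  obtain \<theta>s where "c = concat \<theta>s \<frown> (\<lambda>_. j)"
    using assms unfolding position_def by blast
  then have "\<forall>i\<ge>length (concat \<theta>s). c i = j" by (simp add: conc_def)
  then show ?thesis by blast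
qed

lemma position_initial:
  assumes "enumeration_system w" and "below \<beta> \<alpha>"
  shows "\<exists>c p. position w \<alpha> 0 \<beta> c p"
proof (cases \<alpha>)
  case (Ordinal a)
  then have "\<beta> < a" using assms(2) by simp
  then obtain v where v: "w a v = \<beta>" using enumeration_system_surj[OF assms(1)] by blast
  have "a \<noteq> 0" using \<open>\<beta> < a\<close> omega1_zero_le[of \<beta>] by auto
  then have "length [v] = Suc 0 \<and> descent w a [v] \<noteq> None \<and> foldl w a [v] = \<beta>"
    using v by simp
  then show ?thesis
    unfolding position_def Ordinal level.case using staircase.base by blast
next
  case Naturals
  then show ?thesis
    unfolding position_def using staircase.base by auto
qed

text \<open>The opponent's move: after \<open>L\<close> further entries of color \<open>j\<close>, color \<open>j + 1\<close> takes over.\<close>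

lemma position_extend:
  assumes "enumeration_system w" and "position w \<alpha> j \<gamma> c p" and "\<delta> < \<gamma>"
  shows "\<exists>c' p'. position w \<alpha> (Suc j) \<delta> c' p' \<and> agree L c c' \<and> agree L p p'"
proof -
  obtain \<theta>s where st: "staircase j \<theta>s" and c: "c = concat \<theta>s \<frown> (\<lambda>_. j)"
    and rest: "case \<alpha> of
        Ordinal a \<Rightarrow> \<exists>vs. length vs = Suc j \<and> descent w a vs \<noteq> None \<and> foldl w a vs = \<gamma> \<and>
          p = encode (weave \<theta>s vs (\<lambda>_. j))
      | Naturals \<Rightarrow> p = c"
    using assms unfolding position_def by blast
  let ?\<theta> = "replicate L j @ [Suc j]"
  define c' where "c' = concat (\<theta>s @ [?\<theta>]) \<frown> (\<lambda>_. Suc j)"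
  have st': "staircase (Suc j) (\<theta>s @ [?\<theta>])" using st by (rule staircase.step)
  have agree_c: "agree L c c'"
    by (auto simp: c c'_def conc_def nth_append)
  show ?thesis
  proof (cases \<alpha>)
    case (Ordinal a)
    then obtain vs where vs: "length vs = Suc j" "descent w a vs \<noteq> None" "foldl w a vs = \<gamma>"
        "p = encode (weave \<theta>s vs (\<lambda>_. j))"
      using rest by auto
    obtain v where v: "w \<gamma> v = \<delta>" using enumeration_system_surj[OF assms(1,3)] by blast
    define p' where "p' = encode (weave (\<theta>s @ [?\<theta>]) (vs @ [v]) (\<lambda>_. Suc j))"
    have "\<gamma> \<noteq> 0" using assms(3) omega1_zero_le[of \<delta>] by auto
    then have "descent w a (vs @ [v]) \<noteq> None" using vs descent_snoc by blast
    moreover have "foldl w a (vs @ [v]) = \<delta>" using vs v by simp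
    ultimately have "position w \<alpha> (Suc j) \<delta> c' p'"
      unfolding position_def Ordinal level.case
      using st' c'_def p'_def vs(1) by (intro exI[of _ "\<theta>s @ [?\<theta>]"] conjI exI[of _ "vs @ [v]"]) auto
    moreover have len: "length \<theta>s = length vs" using staircase_props[OF st] vs(1) by simp
    have "agree L (weave \<theta>s vs (\<lambda>_. j)) (weave (\<theta>s @ [?\<theta>]) (vs @ [v]) (\<lambda>_. Suc j))"
      using weave_append[OF len, of "[]" "[]" "\<lambda>_. j"] weave_append[OF len, of "[?\<theta>]" "[v]"]
      by (auto simp: weave_Nil weave_Cons conc_def nth_append)
    then have "agree L p p'"
      unfolding vs(4) p'_def encode_eq_iff .
    ultimately show ?thesis using agree_c by blast
  next
    case Naturals
    then have "position w \<alpha> (Suc j) \<delta> c' c'"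
      unfolding position_def using st' c'_def by auto
    then show ?thesis using agree_c rest Naturals by auto
  qed
qed


section \<open>The ordinals spent by a solver\<close>

text \<open>
  What an output commits a functional to: the set \<open>A\<close> and the numbers \<open>vs\<close> behind its marks. The
  predicate does not mention the coloring, so that outputs on different instances can be compared.
\<close>

definition answer ::
    "(omega1 \<Rightarrow> nat \<Rightarrow> omega1) \<Rightarrow> omega1 \<Rightarrow> (nat \<Rightarrow> nat) \<Rightarrow> nat set \<Rightarrow> nat list \<Rightarrow> bool" where
  "answer w \<beta> s A vs \<longleftrightarrow> infinite A \<and> descent w \<beta> vs \<noteq> None \<and>
    (\<exists>\<phi>s q. length \<phi>s = length vs \<and> concat \<phi>s \<frown> q = indicator A \<and> s = encode (weave \<phi>s vs q))"

lemma is_solution_answer: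
  assumes "is_solution code w n \<beta> c s"
  shows "\<exists>A vs. answer w \<beta> s A vs \<and> card (colors code n c A) \<le> length vs"
proof -
  obtain k A \<phi>s vs q where "length \<phi>s = k" "length vs = k" "infinite A"
      "concat \<phi>s \<frown> q = indicator A" "card (colors code n c A) \<le> k"
      "descent w \<beta> vs \<noteq> None" "s = encode (weave \<phi>s vs q)"
    using assms unfolding is_solution_def by metis
  then have "answer w \<beta> s A vs \<and> card (colors code n c A) \<le> length vs"
    unfolding answer_def by metis
  then show ?thesis by blast
qed

lemma answer_stable:
  assumes "answer w \<beta> s A vs"
  shows "\<exists>N. \<forall>s' A' vs'. agree N s s' \<longrightarrow> answer w \<beta> s' A' vs' \<longrightarrow>
    take (length vs) vs' = vs \<and> A' \<inter> {..<M} = A \<inter> {..<M}"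
proof -
  obtain \<phi>s q where s: "length \<phi>s = length vs" "concat \<phi>s \<frown> q = indicator A"
      "s = encode (weave \<phi>s vs q)"
    using assms unfolding answer_def by blast
  let ?N = "length (concat \<phi>s) + 2 * length \<phi>s + M"
  have "take (length vs) vs' = vs \<and> A' \<inter> {..<M} = A \<inter> {..<M}"
    if ag: "agree ?N s s'" and ans': "answer w \<beta> s' A' vs'" for s' A' vs'
  proof -
    obtain \<phi>s' q' where s': "length \<phi>s' = length vs'" "concat \<phi>s' \<frown> q' = indicator A'"
        "s' = encode (weave \<phi>s' vs' q')"
      using ans' unfolding answer_def by blast
    have "agree ?N (weave \<phi>s vs q) (weave \<phi>s' vs' q')"
      using ag unfolding s(3) s'(3) encode_eq_iff .
    then have *: "take (length vs) vs' = vs"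
        "agree M (indicator A :: nat \<Rightarrow> nat) (indicator A')"
      using weave_initial_segment[OF s(1) s'(1), where M = M and r = q and r' = q'] unfolding s(2) s'(2) by blast+
    have "x \<in> A' \<longleftrightarrow> x \<in> A" if "x < M" for x
    proof -
      have "(indicator A' x :: nat) = indicator A x" using *(2) that by blast
      then show ?thesis by (simp add: indicator_def of_bool_eq_iff)
    qed
    then show ?thesis using *(1) by auto
  qed
  then show ?thesis by blast
qed

lemma colors_eventual:
  assumes "n \<ge> 1" and "bij_betw code ([UNIV]\<^bsup>n\<^esup>) UNIV" and "infinite A"
    and "\<And>i. i \<ge> M \<Longrightarrow> c i = j"
  shows "j \<in> colors code n c A"
proof -
  have "inj_on code ([A]\<^bsup>n\<^esup>)"
    using assms(2) by (meson bij_betw_def inj_on_subset nsets_mono subset_UNIV)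
  moreover have "infinite ([A]\<^bsup>n\<^esup>)"
    using assms(1,3) infinite_imp_infinite_nsets[of A n] by simp
  ultimately have "infinite (code ` [A]\<^bsup>n\<^esup>)"
    using finite_imageD by blast
  then obtain x where "x \<ge> M" and "x \<in> code ` [A]\<^bsup>n\<^esup>"
    unfolding infinite_nat_iff_unbounded_le by blast
  then obtain X where X: "X \<in> [A]\<^bsup>n\<^esup>" "code X \<ge> M"
    by (elim imageE) simp
  then have "j = c (code X)" using assms(4) by simp
  then show ?thesis
    unfolding colors_def using X(1) by (rule image_eqI)
qed

text \<open>
  Finitely many colors of \<open>A\<close> are witnessed by finitely many \<open>n\<close>-sets, hence by finite parts of the
  set and of the coloring.
\<close>

lemma colors_stable:
  assumes "finite J" and "J \<subseteq> colors code n c A"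
  shows "\<exists>M. \<forall>c' A'. agree M c c' \<longrightarrow> A' \<inter> {..<M} = A \<inter> {..<M} \<longrightarrow> J \<subseteq> colors code n c' A'"
proof -
  have "\<forall>a\<in>J. \<exists>X. X \<in> [A]\<^bsup>n\<^esup> \<and> c (code X) = a"
    using assms(2) unfolding colors_def by blast
  then obtain X where X: "\<And>a. a \<in> J \<Longrightarrow> X a \<in> [A]\<^bsup>n\<^esup>" "\<And>a. a \<in> J \<Longrightarrow> c (code (X a)) = a"
    by metis
  have "finite (\<Union>a\<in>J. insert (code (X a)) (X a))"
    using assms(1) X(1) by (auto simp: nsets_def)
  then obtain M where M: "\<And>x. x \<in> (\<Union>a\<in>J. insert (code (X a)) (X a)) \<Longrightarrow> x < M"
    unfolding finite_nat_set_iff_bounded by blast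
  have "a \<in> colors code n c' A'"
    if "a \<in> J" "agree M c c'" "A' \<inter> {..<M} = A \<inter> {..<M}" for a c' A'
  proof -
    have "X a \<subseteq> A \<inter> {..<M}" using that(1) X(1) M by (auto simp: nsets_def)
    then have "X a \<subseteq> A'" unfolding that(3)[symmetric] by blast
    then have "X a \<in> [A']\<^bsup>n\<^esup>" using X(1)[OF that(1)] by (auto simp: nsets_def)
    moreover have "code (X a) < M" using that(1) M by blast
    then have "a = c' (code (X a))" using that(1,2) X(2) by simp
    ultimately show ?thesis unfolding colors_def by (intro image_eqI)
  qed
  then show ?thesis by blast
qed

text \<open>
  The invariant for a single functional when color \<open>j\<close> has just been introduced: if it solves
  the instance, its set shows all earlier colors, and the last of its first \<open>j\<close> ordinals
  (\<open>\<beta>\<close> when \<open>j = 0\<close>) is at most the ordinal \<open>\<gamma>\<close> of the opponent.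
\<close>

definition pressed ::
    "(nat set \<Rightarrow> nat) \<Rightarrow> (omega1 \<Rightarrow> nat \<Rightarrow> omega1) \<Rightarrow> nat \<Rightarrow> level \<Rightarrow> omega1 \<Rightarrow> functional \<Rightarrow>
      nat \<Rightarrow> omega1 \<Rightarrow> (nat \<Rightarrow> nat) \<Rightarrow> (nat \<Rightarrow> nat) \<Rightarrow> bool" where
  "pressed code w n \<alpha> \<beta> \<Theta> j \<gamma> c p \<longleftrightarrow>
    (solves \<Theta> (RT code w n \<alpha> \<beta>) p \<longrightarrow>
      (\<forall>s A vs. \<Theta> p = (\<lambda>i. Some (Val (s i))) \<longrightarrow> answer w \<beta> s A vs \<longrightarrow>
        {..<j} \<subseteq> colors code n c A \<and> j \<le> length vs \<and> foldl w \<beta> (take j vs) \<le> \<gamma>))"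

lemma pressed_mono:
  assumes "pressed code w n \<alpha> \<beta> \<Theta> j \<gamma> c p" and "\<gamma> \<le> \<gamma>'"
  shows "pressed code w n \<alpha> \<beta> \<Theta> j \<gamma>' c p"
  using assms unfolding pressed_def by (meson order_trans)

text \<open>
  The set \<open>A\<close> of a solving functional also shows color \<open>j\<close>, which \<open>c\<close> takes on all but finitely many
  \<open>n\<close>-sets. With \<open>j + 1\<close> colors it needs a \<open>(j + 1)\<close>-st mark, whose ordinal \<open>\<delta>\<close> lies strictly below the
  previous one and so below \<open>\<gamma>\<close>. All of this depends on finite prefixes only, so it survives
  every sufficiently late change of the instance.
\<close>

lemma pressed_step:
  assumes n: "n \<ge> 1" and code: "bij_betw code ([UNIV]\<^bsup>n\<^esup>) UNIV"
    and w: "enumeration_system w"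
    and cont: "continuous_functional \<Theta>" and err: "identifies_errors \<Theta> (RT code w n \<alpha> \<beta>)"
    and pos: "position w \<alpha> j \<gamma> c p" and pr: "pressed code w n \<alpha> \<beta> \<Theta> j \<gamma> c p"
    and sol: "solves \<Theta> (RT code w n \<alpha> \<beta>) p"
  shows "\<exists>\<delta><\<gamma>. \<exists>L. \<forall>c' q. agree L c c' \<longrightarrow> agree L p q \<longrightarrow>
    pressed code w n \<alpha> \<beta> \<Theta> (Suc j) \<delta> c' q"
proof -
  have name: "is_name w \<alpha> c p" using pos by (rule position_is_name)
  then have inst: "p \<in> instances (RT code w n \<alpha> \<beta>)" by (auto simp: RT_def)
  obtain s c0 where s: "\<Theta> p = (\<lambda>i. Some (Val (s i)))"
    and c0: "is_name w \<alpha> c0 p" "is_solution code w n \<beta> c0 s"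
    using sol unfolding solves_def RT_def by auto
  have "c0 = c" using is_name_unique name c0(1) by blast
  then obtain A vs where ans: "answer w \<beta> s A vs" and card: "card (colors code n c A) \<le> length vs"
    using is_solution_answer c0(2) by blast
  have old: "{..<j} \<subseteq> colors code n c A" "foldl w \<beta> (take j vs) \<le> \<gamma>"
    using pr sol s ans unfolding pressed_def by blast+
  obtain M where "\<forall>i\<ge>M. c i = j" using position_eventually_constant[OF pos] by blast
  then have "j \<in> colors code n c A"
    using colors_eventual[OF n code, of A M c j] ans unfolding answer_def by blast
  then have new: "{..<Suc j} \<subseteq> colors code n c A"
    using old(1) by (auto simp: less_Suc_eq)
  have "finite (range c)"
    using name by (cases \<alpha>) auto
  then have "finite (colors code n c A)"
    by (rule rev_finite_subset) (auto simp: colors_def)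
  then have "card {..<Suc j} \<le> card (colors code n c A)"
    using new by (rule card_mono)
  then have len: "Suc j \<le> length vs" using card by simp
  define \<delta> where "\<delta> = foldl w \<beta> (take (Suc j) vs)"
  have "\<delta> < foldl w \<beta> (take j vs)"
    using descent_decreases[OF w, of \<beta> vs j] ans len unfolding \<delta>_def answer_def by auto
  then have "\<delta> < \<gamma>" using old(2) by (rule order.strict_trans2)
  obtain M1 where M1: "\<And>c' A'. agree M1 c c' \<Longrightarrow> A' \<inter> {..<M1} = A \<inter> {..<M1} \<Longrightarrow>
      {..<Suc j} \<subseteq> colors code n c' A'"
    using colors_stable[OF _ new] by blast
  obtain N where N: "\<And>s' A' vs'. agree N s s' \<Longrightarrow> answer w \<beta> s' A' vs' \<Longrightarrow>
      take (length vs) vs' = vs \<and> A' \<inter> {..<M1} = A \<inter> {..<M1}"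
    using answer_stable[OF ans] by blast
  obtain L where L: "\<And>q. agree L p q \<Longrightarrow> solves \<Theta> (RT code w n \<alpha> \<beta>) q \<Longrightarrow> agree N (\<Theta> p) (\<Theta> q)"
    using agree_if_eventually_nhds[OF eventually_solves_only_if[OF cont err inst, of N]] by blast
  have "pressed code w n \<alpha> \<beta> \<Theta> (Suc j) \<delta> c' q"
    if c': "agree (max L M1) c c'" and q: "agree (max L M1) p q" for c' q
    unfolding pressed_def
  proof (intro impI allI)
    fix s' A' vs'
    assume solq: "solves \<Theta> (RT code w n \<alpha> \<beta>) q" and s': "\<Theta> q = (\<lambda>i. Some (Val (s' i)))"
      and ans': "answer w \<beta> s' A' vs'"
    have "agree N (\<Theta> p) (\<Theta> q)" using L q solq by simp
    then have "agree N s s'" unfolding s s' by simp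
    then have *: "take (length vs) vs' = vs" "A' \<inter> {..<M1} = A \<inter> {..<M1}"
      using N ans' by blast+
    have "{..<Suc j} \<subseteq> colors code n c' A'"
      using M1 c' *(2) by simp
    moreover have "length vs \<le> length vs'"
      using arg_cong[OF *(1), of length] by simp
    moreover have "take (Suc j) vs' = take (Suc j) vs"
      using arg_cong[OF *(1), of "take (Suc j)"] len by (simp add: min_absorb1)
    ultimately show "{..<Suc j} \<subseteq> colors code n c' A' \<and> Suc j \<le> length vs' \<and>
        foldl w \<beta> (take (Suc j) vs') \<le> \<delta>"
      using len by (simp add: \<delta>_def)
  qed
  then show ?thesis using \<open>\<delta> < \<gamma>\<close> by blast
qed

text \<open>
  The infinite descent. The next ordinal of the opponent is the largest of the bounds for the
  single functionals; it is below \<open>\<gamma>\<close> because there are only finitely many functionals.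
\<close>

lemma pressed_position_impossible:
  fixes m :: nat
  assumes n: "n \<ge> 1" and code: "bij_betw code ([UNIV]\<^bsup>n\<^esup>) UNIV"
    and w: "enumeration_system w"
    and \<Theta>: "\<And>i. i < m \<Longrightarrow> continuous_functional (\<Theta> i)"
      "\<And>i. i < m \<Longrightarrow> identifies_errors (\<Theta> i) (RT code w n \<alpha> \<beta>)"
    and cover: "\<And>p. p \<in> instances (RT code w n \<alpha> \<beta>) \<Longrightarrow> \<exists>i<m. solves (\<Theta> i) (RT code w n \<alpha> \<beta>) p"
    and pos: "position w \<alpha> j \<gamma> c p"
    and pr: "\<And>i. i < m \<Longrightarrow> pressed code w n \<alpha> \<beta> (\<Theta> i) j \<gamma> c p"
  shows False
  using pos pr
proof (induction \<gamma> arbitrary: j c p rule: less_induct)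
  case (less \<gamma>)
  have inst: "p \<in> instances (RT code w n \<alpha> \<beta>)"
    using position_is_name[OF less.prems(1)] by (auto simp: RT_def)
  have step: "\<exists>\<delta><\<gamma>. \<exists>L. \<forall>c' q. agree L c c' \<longrightarrow> agree L p q \<longrightarrow>
      pressed code w n \<alpha> \<beta> (\<Theta> i) (Suc j) \<delta> c' q"
    if i: "i < m" and sol: "solves (\<Theta> i) (RT code w n \<alpha> \<beta>) p" for i
    by (rule pressed_step[OF n code w \<Theta>(1)[OF i] \<Theta>(2)[OF i] less.prems(1) less.prems(2)[OF i] sol])
  obtain i0 where i0: "i0 < m" "solves (\<Theta> i0) (RT code w n \<alpha> \<beta>) p"
    using cover inst by blast
  \<comment> \<open>A functional that fails at \<open>p\<close> imposes no bound; any ordinal below \<open>\<gamma>\<close> serves for it, and some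
    solving functional shows that there is one.\<close>
  then obtain \<delta>0 where \<delta>0: "\<delta>0 < \<gamma>" using step by blast
  have "\<exists>\<delta> L. \<delta> < \<gamma> \<and> (\<forall>c' q. agree L c c' \<longrightarrow> agree L p q \<longrightarrow>
      pressed code w n \<alpha> \<beta> (\<Theta> i) (Suc j) \<delta> c' q)" if i: "i < m" for i
  proof (cases "solves (\<Theta> i) (RT code w n \<alpha> \<beta>) p")
    case True
    then show ?thesis using step i by blast
  next
    case False
    obtain L where L: "\<And>q. agree L p q \<Longrightarrow> solves (\<Theta> i) (RT code w n \<alpha> \<beta>) q \<Longrightarrow>
        solves (\<Theta> i) (RT code w n \<alpha> \<beta>) p"
      using agree_if_eventually_nhds[OF
          eventually_solves_only_if[OF \<Theta>(1)[OF i] \<Theta>(2)[OF i] inst, of 0]] by blast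
    have "pressed code w n \<alpha> \<beta> (\<Theta> i) (Suc j) \<delta>0 c' q" if "agree L p q" for c' q
    proof -
      have "\<not> solves (\<Theta> i) (RT code w n \<alpha> \<beta>) q" using L[OF that] False by blast
      then show ?thesis by (simp add: pressed_def)
    qed
    then show ?thesis using \<delta>0 by blast
  qed
  then obtain \<delta> L where \<delta>: "\<And>i. i < m \<Longrightarrow> \<delta> i < \<gamma>"
    and L: "\<And>i c' q. i < m \<Longrightarrow> agree (L i) c c' \<Longrightarrow> agree (L i) p q \<Longrightarrow>
      pressed code w n \<alpha> \<beta> (\<Theta> i) (Suc j) (\<delta> i) c' q"
    by metis
  let ?\<delta> = "Max (\<delta> ` {..<m})" and ?L = "Max (L ` {..<m})"
  have "?\<delta> \<in> \<delta> ` {..<m}" using i0(1) by (intro Max_in) auto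
  then have lt: "?\<delta> < \<gamma>" using \<delta> by auto
  then obtain c' p' where pos': "position w \<alpha> (Suc j) ?\<delta> c' p'" and ag: "agree ?L c c'" "agree ?L p p'"
    using position_extend[OF w less.prems(1) lt, of ?L] by (elim exE conjE)
  have pr': "pressed code w n \<alpha> \<beta> (\<Theta> i) (Suc j) ?\<delta> c' p'" if "i < m" for i
  proof (rule pressed_mono)
    have "L i \<le> ?L" using that by simp
    then show "pressed code w n \<alpha> \<beta> (\<Theta> i) (Suc j) (\<delta> i) c' p'"
      using L[OF that] ag by simp
    show "\<delta> i \<le> ?\<delta>" using that by simp
  qed
  show False by (rule less.IH[OF lt pos' pr'])
qed

theorem RT_not_guessable_with_identified_errors:
  assumes "n \<ge> 1" and "bij_betw code ([UNIV]\<^bsup>n\<^esup>) UNIV"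
    and "enumeration_system w" and "below \<beta> \<alpha>"
  shows "\<not> guessable_with_identified_errors m (RT code w n \<alpha> \<beta>)"
proof
  assume "guessable_with_identified_errors m (RT code w n \<alpha> \<beta>)"
  then obtain \<Theta> where \<Theta>: "\<And>i. i < m \<Longrightarrow> continuous_functional (\<Theta> i)"
      "\<And>i. i < m \<Longrightarrow> identifies_errors (\<Theta> i) (RT code w n \<alpha> \<beta>)"
    and cover: "\<And>p. p \<in> instances (RT code w n \<alpha> \<beta>) \<Longrightarrow> \<exists>i<m. solves (\<Theta> i) (RT code w n \<alpha> \<beta>) p"
    unfolding guessable_with_identified_errors_def by blast
  obtain c p where pos: "position w \<alpha> 0 \<beta> c p"
    using position_initial[OF assms(3,4)] by blast
  have "pressed code w n \<alpha> \<beta> (\<Theta> i) 0 \<beta> c p" for i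
    by (simp add: pressed_def)
  then show False
    using pressed_position_impossible[OF assms(1-3) \<Theta> cover pos] by blast
qed

theorem theorem5p3p5:
  fixes n :: nat
    and code :: "nat set \<Rightarrow> nat"
    and w :: "omega1 \<Rightarrow> nat \<Rightarrow> omega1"
    and \<alpha> :: level
    and \<beta> :: omega1
  assumes "n \<ge> 1"
    and "bij_betw code ([UNIV]\<^bsup>n\<^esup>) UNIV"
    and "enumeration_system w"
    and "below \<beta> \<alpha>"
  shows "\<not> guessable_with_identified_errors 2 (RT code w n \<alpha> \<beta>)"
  using assms by (rule RT_not_guessable_with_identified_errors)

end
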